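(* Let $a<b$ be real, let $g$ be a nonnegative real function on $[-1,1]$ that is analytic in the disc $|z|<r$ for some $r>1$, let $\phi_\omega(x)=\sin(\omega x)$ or $\phi_\omega(x)=\cos(\omega x)$, and define $$\rho_0=2\sum_{k=0}^\infty \frac{g^{(2k)}(0)}{(k!)^2\,4^k},\qquad I_O[f]=\int_a^b f(x)\Big[(g\circ\phi_\omega)(x)-\frac{\rho_0}{2}\Big]dx .$$ Let $n$ be an even positive integer. Suppose that for all sufficiently large $\omega$ there exists a monic polynomial $q_n^\omega$ of degree $n$ with $\int_a^b q_n^\omega(x)x^j\big[(g\circ\phi_\omega)(x)-\rho_0/2\big]dx=0$ for $j=0,\ldots,n-1$, whose zeros $x_1,\ldots,x_n$ (possibly complex) are distinct, and let $w_1,\ldots,w_n$ be weights such that $\sum_{k=1}^n w_k p(x_k)=I_O[p]$ for every polynomial $p$ of degree at most $2n-1$ (the Gaussian rule). Suppose that the nodes can be split into two groups $\{\check{x}_k\}_{k=1}^{n/2}$ and $\{\hat{x}_k\}_{k=1}^{n/2}$ satisfying $$\check{x}_k=a+O(\omega^{-1}),\qquad \hat{x}_k=b+O(\omega^{-1}),\qquad k=1,\ldots,n/2,$$ as $\omega\to\infty$. Then for every function $f$ analytic in a (complex) region containing $[a,b]$, $$I_O[f]-\sum_{k=1}^n w_k f(x_k)=O(\omega^{-n-1}),\qquad \omega\to\infty.$$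
   Context: The integral $\int_a^b f(x)(g\circ\phi_\omega)(x)\,dx$ is split as $I_O[f]+\frac{\rho_0}{2}\int_a^b f(x)\,dx$; the constant $\rho_0$ is the limit value such that $\int_a^b f(x)(g\circ\phi_\omega)(x)dx\to\frac{\rho_0}{2}\int_a^b f(x)dx$ as $\omega\to\infty$. Since $(g\circ\phi_\omega)-\rho_0/2$ may change sign, existence of $q_n^\omega$ is an assumption. All $O(\cdot)$ statements refer to $\omega\to\infty$ with $n$, $f$, $g$, $a$, $b$ fixed. *)

theory Defs
  imports "HOL-Complex_Analysis.Complex_Analysis" "HOL-Computational_Algebra.Polynomial"
    "HOL-Library.Landau_Symbols"
begin

definition rho0 :: "(real \<Rightarrow> real) \<Rightarrow> real" where
  "rho0 g = 2 * (\<Sum>k. (deriv ^^ (2*k)) g 0 / ((fact k)^2 * 4^k))"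

definition IO :: "(real \<Rightarrow> real) \<Rightarrow> (real \<Rightarrow> real) \<Rightarrow> real \<Rightarrow> real \<Rightarrow> real
    \<Rightarrow> (complex \<Rightarrow> complex) \<Rightarrow> complex" where
  "IO g phi a b \<omega> f =
     integral {a..b} (\<lambda>x. f (complex_of_real x) * complex_of_real (g (phi (\<omega> * x)) - rho0 g / 2))"

end

theory Submission
  imports Defs "HOL-Library.Periodic_Fun"
begin

text \<open>
  Let \<open>W\<close> be the monic polynomial whose zeros are the nodes. Dividing \<open>f\<close> by the doubled nodes gives
  \<open>f = p + W\<^sup>2 R\<close> with \<open>p\<close> of degree at most \<open>2n - 1\<close> and \<open>R\<close> holomorphic and bounded uniformly in \<open>\<omega>\<close>.
  The rule is exact on \<open>p\<close> and vanishes on \<open>W\<^sup>2 R\<close>, so the error is the oscillatory integral of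
  \<open>W\<^sup>2 R\<close>. The constant \<open>rho0 g / 2\<close> is the mean of \<open>g \<circ> phi\<close> over a period, hence the oscillating factor
  has bounded iterated antiderivatives and one can integrate by parts \<open>n + 1\<close> times. Since \<open>W\<^sup>2\<close> has \<open>n\<close>
  zeros within \<open>O(1/\<omega>)\<close> of each endpoint, the \<open>k\<close>-th derivative of \<open>W\<^sup>2 R\<close> there is \<open>O(\<omega>^(k - n))\<close>, and
  all boundary terms are \<open>O(\<omega>^(-n-1))\<close>.
\<close>

section \<open>Interpolation remainders of holomorphic functions\<close>

text \<open>Radii add up: a closed disc of radius \<open>e\<close> around a point of
  \<open>thickening K d\<close> stays in \<open>thickening K (d + e)\<close>. This leaves room for
  Cauchy estimates that are uniform in the point.\<close>

definition thickening :: "complex set \<Rightarrow> real \<Rightarrow> complex set" where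
  "thickening K d = (\<Union>c\<in>K. ball c d)"

text \<open>As a Minkowski sum with a ball, the neighbourhood inherits convexity and boundedness
  from \<open>K\<close>.\<close>

lemma thickening_eq_sums: "thickening K d = (\<Union>x\<in>K. \<Union>y\<in>ball 0 d. {x + y})"
proof -
  have "z \<in> ball c d \<longleftrightarrow> (\<exists>y\<in>ball 0 d. z = c + y)" for c z :: complex
    by (auto simp: dist_norm norm_minus_commute intro!: bexI[of _ "z - c"])
  then show ?thesis by (auto simp: thickening_def)
qed

lemma open_thickening [simp]: "open (thickening K d)"
  by (auto simp: thickening_def)

lemma convex_thickening: "convex K \<Longrightarrow> convex (thickening K d)"
  unfolding thickening_eq_sums by (intro convex_sums) auto

lemma thickening_mono: "d \<le> d' \<Longrightarrow> thickening K d \<subseteq> thickening K d'"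
  by (auto simp: thickening_def)

lemma cball_subset_thickening:
  assumes "z \<in> thickening K d"
  shows "cball z e \<subseteq> thickening K (d + e)"
proof
  fix y assume "y \<in> cball z e"
  moreover obtain c where "c \<in> K" "dist c z < d" using assms by (auto simp: thickening_def)
  ultimately have "dist c y < d + e" using dist_triangle[of c y z] by auto
  with \<open>c \<in> K\<close> show "y \<in> thickening K (d + e)" by (auto simp: thickening_def)
qed

lemma holomorphic_on_thickening_deriv_bound:
  assumes hol: "f holomorphic_on thickening K (d + e)" and "e > 0"
    and M: "\<And>z. z \<in> thickening K (d + e) \<Longrightarrow> norm (f z) \<le> M"
    and z: "z \<in> thickening K d"
  shows "norm ((deriv ^^ k) f z) \<le> fact k * M / e ^ k"
proof -
  note sub = cball_subset_thickening[OF z, of e]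
  then have hb: "f holomorphic_on cball z e" by (rule holomorphic_on_subset[OF hol])
  show ?thesis
  proof (rule Cauchy_inequality)
    show "f holomorphic_on ball z e" by (rule holomorphic_on_subset[OF hb]) auto
    show "continuous_on (cball z e) f" using hb by (rule holomorphic_on_imp_continuous_on)
    show "e > 0" by fact
    fix y assume "norm (z - y) = e"
    then have "y \<in> cball z e" by (simp add: dist_norm)
    with sub M show "norm (f y) \<le> M" by auto
  qed
qed

text \<open>The singularity of the difference quotient at \<open>c\<close> is removable. By
  convexity the mean value inequality bounds the quotient by the supremum of the derivative of
  \<open>f\<close>, and Cauchy's inequality bounds that by \<open>M / e\<close>. The last identity
  holds for all \<open>z\<close>, as it only rearranges the definition of the quotient.\<close>

lemma holomorphic_divide_linear_factor:
  assumes "convex K" and hol: "f holomorphic_on thickening K (d + e)" and "e > 0"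
    and M: "\<And>z. z \<in> thickening K (d + e) \<Longrightarrow> norm (f z) \<le> M"
    and c: "c \<in> thickening K d"
  obtains F where "F holomorphic_on thickening K (d + e)"
    and "\<And>z. z \<in> thickening K d \<Longrightarrow> norm (F z) \<le> M / e"
    and "\<And>z. f z = f c + (z - c) * F z"
proof
  let ?F = "\<lambda>z. if z = c then deriv f c else (f z - f c) / (z - c)"
  show "?F holomorphic_on thickening K (d + e)"
    using hol by (intro pole_lemma_open) auto
  have sub: "thickening K d \<subseteq> thickening K (d + e)" using \<open>e > 0\<close> by (intro thickening_mono) auto
  have db: "norm (deriv f z) \<le> M / e" if "z \<in> thickening K d" for z
    using holomorphic_on_thickening_deriv_bound[OF hol \<open>e > 0\<close> M that, of 1] by simp
  show "norm (?F z) \<le> M / e" if z: "z \<in> thickening K d" for z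
  proof (cases "z = c")
    case False
    have "norm (f z - f c) \<le> M / e * norm (z - c)"
    proof (rule field_differentiable_bound[OF convex_thickening[OF \<open>convex K\<close>] _ db z c])
      fix u assume "u \<in> thickening K d"
      then show "(f has_field_derivative deriv f u) (at u within thickening K d)"
        using holomorphic_derivI[OF hol, of u] sub by (auto intro: has_field_derivative_at_within)
    qed
    with False show ?thesis by (simp add: norm_divide divide_le_eq)
  qed (use db c in auto)
qed auto

text \<open>Dividing out one node at a time costs a factor \<open>1 / e\<close> each, so the remainder bound does not
  depend on the positions of the nodes, which may coalesce.\<close>

lemma holomorphic_interpolation_remainder:
  assumes "convex K" "e > 0"
    and "f holomorphic_on thickening K (d + real m * e)"
    and "\<And>z. z \<in> thickening K (d + real m * e) \<Longrightarrow> norm (f z) \<le> M"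
    and "\<And>i. i < m \<Longrightarrow> y i \<in> thickening K d"
  shows "\<exists>p R. (\<forall>i\<ge>m. coeff p i = 0) \<and> R holomorphic_on thickening K d
    \<and> (\<forall>z\<in>thickening K d. norm (R z) \<le> M / e ^ m)
    \<and> (\<forall>z. f z = poly p z + (\<Prod>i<m. z - y i) * R z)"
  using assms(3-5)
proof (induction m arbitrary: f M)
  case 0
  \<comment> \<open>Without nodes \<open>p\<close> is zero. A degree bound could not single it out,
    since every constant has degree 0; hence the condition on coefficients.\<close>
  then show ?case by (intro exI[of _ 0] exI[of _ f]) auto
next
  case (Suc m)
  have eq: "d + real (Suc m) * e = d + real m * e + e" by (simp add: algebra_simps)
  have sub: "thickening K d \<subseteq> thickening K (d + real m * e)"
    using \<open>e > 0\<close> by (intro thickening_mono) auto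
  have sub2: "thickening K (d + real m * e) \<subseteq> thickening K (d + real m * e + e)"
    using \<open>e > 0\<close> by (intro thickening_mono) auto
  \<comment> \<open>One node is split off first: the quotient is bounded on a neighbourhood smaller
    by \<open>e\<close>, as the induction hypothesis for the other \<open>m\<close> nodes
    requires.\<close>
  obtain F where F: "F holomorphic_on thickening K (d + real m * e + e)"
      "\<And>z. z \<in> thickening K (d + real m * e) \<Longrightarrow> norm (F z) \<le> M / e"
      "\<And>z. f z = f (y m) + (z - y m) * F z"
    using holomorphic_divide_linear_factor[OF \<open>convex K\<close> Suc.prems(1)[unfolded eq] \<open>e > 0\<close>
        Suc.prems(2)[unfolded eq], of "y m"] sub Suc.prems(3)[of m] by blast
  obtain p R where pR: "\<forall>i\<ge>m. coeff p i = 0" "R holomorphic_on thickening K d"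
      "\<forall>z\<in>thickening K d. norm (R z) \<le> M / e / e ^ m"
      "\<forall>z. F z = poly p z + (\<Prod>i<m. z - y i) * R z"
    using Suc.IH[OF holomorphic_on_subset[OF F(1) sub2] F(2)] Suc.prems(3) by force
  let ?p = "[:f (y m):] + [:- y m, 1:] * p"
  have "coeff ?p i = 0" if "i \<ge> Suc m" for i
    using that pR(1) by (cases i) auto
  moreover have "f z = poly ?p z + (\<Prod>i<Suc m. z - y i) * R z" for z
    using F(3)[of z] pR(4) by (simp add: algebra_simps)
  moreover have "\<forall>z\<in>thickening K d. norm (R z) \<le> M / e ^ Suc m"
    using pR(3) by (simp add: divide_simps mult.commute)
  ultimately show ?case
    using pR(2) by blast
qed

section \<open>Oscillatory integrals\<close>

text \<open>The function \<open>H1 (\<omega> * x) / \<omega>\<close> is an antiderivative of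
  \<open>H0 (\<omega> * x)\<close>, so each step gains a factor \<open>1 / \<omega>\<close> at the
  cost of one derivative of \<open>e\<close>.\<close>

lemma oscillatory_integration_by_parts:
  fixes H0 H1 :: "real \<Rightarrow> real"
  assumes "a \<le> b" "\<omega> > 0" "open T" "complex_of_real ` {a..b} \<subseteq> T" "e holomorphic_on T"
    and H1: "\<And>t. (H1 has_real_derivative H0 t) (at t)" and H0: "continuous_on UNIV H0"
  shows "integral {a..b} (\<lambda>x. e (of_real x) * of_real (H0 (\<omega> * x))) =
    (e (of_real b) * of_real (H1 (\<omega> * b)) - e (of_real a) * of_real (H1 (\<omega> * a))
     - integral {a..b} (\<lambda>x. deriv e (of_real x) * of_real (H1 (\<omega> * x)))) / of_real \<omega>"
proof -
  have H1c: "continuous_on UNIV H1"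
    using H1 by (meson DERIV_continuous_on has_field_derivative_at_within)
  have c: "continuous_on {a..b} (\<lambda>x. u (of_real x) * complex_of_real (h (\<omega> * x)))"
    if "u holomorphic_on T" "continuous_on UNIV h" for u h
    by (intro continuous_intros continuous_on_compose2[OF holomorphic_on_imp_continuous_on[OF that(1)]]
        continuous_on_compose2[OF that(2)]) (use assms in auto)
  have ce: "continuous_on {a..b} (\<lambda>x. e (of_real x) * of_real (H0 (\<omega> * x)))"
    and cd: "continuous_on {a..b} (\<lambda>x. deriv e (of_real x) * of_real (H1 (\<omega> * x)))"
    using c[OF \<open>e holomorphic_on T\<close> H0] c[OF holomorphic_deriv[OF \<open>e holomorphic_on T\<close> \<open>open T\<close>] H1c]
    by auto
  let ?P = "\<lambda>x. e (of_real x) * of_real (H1 (\<omega> * x))"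
  have "((\<lambda>x. deriv e (of_real x) * of_real (H1 (\<omega> * x))
      + of_real \<omega> * (e (of_real x) * of_real (H0 (\<omega> * x)))) has_integral ?P b - ?P a) {a..b}"
  proof (rule fundamental_theorem_of_calculus[OF \<open>a \<le> b\<close>])
    fix x assume x: "x \<in> {a..b}"
    have "(e has_field_derivative deriv e (of_real x)) (at (of_real x))"
      using x assms by (intro holomorphic_derivI[OF _ \<open>open T\<close>]) auto
    then have 1: "((\<lambda>x. e (of_real x)) has_vector_derivative deriv e (of_real x)) (at x within {a..b})"
      using has_field_derivative_at_within has_vector_derivative_at_within has_vector_derivative_real_field by blast
    have "((\<lambda>x. H1 (\<omega> * x)) has_real_derivative H0 (\<omega> * x) * \<omega>) (at x within {a..b})"
      by (rule DERIV_chain2[OF H1]) (auto intro!: derivative_eq_intros)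
    then have 2: "((\<lambda>x. complex_of_real (H1 (\<omega> * x)))
        has_vector_derivative of_real (H0 (\<omega> * x) * \<omega>)) (at x within {a..b})"
      using has_vector_derivative_of_real has_real_derivative_iff_has_vector_derivative by blast
    show "(?P has_vector_derivative deriv e (of_real x) * of_real (H1 (\<omega> * x))
      + of_real \<omega> * (e (of_real x) * of_real (H0 (\<omega> * x)))) (at x within {a..b})"
      using has_vector_derivative_mult[OF 1 2] by (simp add: algebra_simps)
  qed
  then have "?P b - ?P a = integral {a..b} (\<lambda>x. deriv e (of_real x) * of_real (H1 (\<omega> * x))
      + of_real \<omega> * (e (of_real x) * of_real (H0 (\<omega> * x))))"
    by (simp add: integral_unique)
  also have "\<dots> = integral {a..b} (\<lambda>x. deriv e (of_real x) * of_real (H1 (\<omega> * x)))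
      + of_real \<omega> * integral {a..b} (\<lambda>x. e (of_real x) * of_real (H0 (\<omega> * x)))"
    by (subst integral_add) (auto intro!: integrable_continuous_real continuous_intros ce cd)
  finally show ?thesis using \<open>\<omega> > 0\<close> by (simp add: field_simps)
qed

text \<open>Induction on \<open>N\<close> passes from \<open>e\<close> and \<open>j\<close> to
  \<open>deriv e\<close> and \<open>Suc j\<close>, so \<open>B\<close> has to cover the
  antiderivatives up to \<open>H (j + N)\<close>. The integral left after \<open>N\<close> steps is
  estimated trivially.\<close>

lemma oscillatory_integral_bound:
  fixes H :: "nat \<Rightarrow> real \<Rightarrow> real"
  assumes ab: "a \<le> b" "\<omega> > 0" "open T" "complex_of_real ` {a..b} \<subseteq> T" and e: "e holomorphic_on T"
    and H: "\<And>j t. (H (Suc j) has_real_derivative H j t) (at t)" and H0: "continuous_on UNIV (H 0)"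
    and B: "\<And>i t. i \<le> j + N \<Longrightarrow> \<bar>H i t\<bar> \<le> B"
    and D: "\<And>x. x \<in> {a..b} \<Longrightarrow> norm ((deriv ^^ N) e (of_real x)) \<le> D"
  shows "norm (integral {a..b} (\<lambda>x. e (of_real x) * of_real (H j (\<omega> * x)))) \<le>
    (\<Sum>k<N. B / \<omega> ^ Suc k * (norm ((deriv ^^ k) e (of_real a)) + norm ((deriv ^^ k) e (of_real b))))
    + B * D * (b - a) / \<omega> ^ N"
  using e B D
proof (induction N arbitrary: e j)
  have Hc: "continuous_on UNIV (H i)" for i
  proof (cases i)
    case (Suc k)
    then show ?thesis using H[of k] by (meson DERIV_continuous_on has_field_derivative_at_within)
  qed (use H0 in simp)
  {
    case (0 e j)
    have "norm (integral {a..b} (\<lambda>x. e (of_real x) * of_real (H j (\<omega> * x)))) \<le> (D * B) * (b - a)"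
    proof (rule integral_bound[OF ab(1)])
      show "continuous_on {a..b} (\<lambda>x. e (of_real x) * complex_of_real (H j (\<omega> * x)))"
        by (intro continuous_intros continuous_on_compose2[OF holomorphic_on_imp_continuous_on[OF 0(1)]]
            continuous_on_compose2[OF Hc]) (use ab in auto)
      fix t assume t: "t \<in> {a..b}"
      show "norm (e (of_real t) * complex_of_real (H j (\<omega> * t))) \<le> D * B"
        unfolding norm_mult using 0(2)[of j "\<omega> * t"] 0(3)[OF t] order_trans[OF norm_ge_zero 0(3)[OF t]]
        by (intro mult_mono) auto
    qed
    then show ?case by (simp add: mult_ac)
  next
    case (Suc N e j)
    let ?I = "integral {a..b} (\<lambda>x. deriv e (of_real x) * of_real (H (Suc j) (\<omega> * x)))"
    let ?E = "\<lambda>k. norm ((deriv ^^ k) e (of_real a)) + norm ((deriv ^^ k) e (of_real b))"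
    have sw: "(deriv ^^ k) (deriv e) = (deriv ^^ Suc k) e" for k by (simp add: funpow_Suc_right del: funpow.simps)
    have IH: "norm ?I \<le> (\<Sum>k<N. B / \<omega> ^ Suc k * ?E (Suc k)) + B * D * (b - a) / \<omega> ^ N"
      using Suc.IH[of "deriv e" "Suc j"] Suc.prems ab(3) by (simp add: sw holomorphic_deriv del: funpow.simps)
    have b1: "norm (e (of_real c) * complex_of_real (H (Suc j) (\<omega> * c))) \<le> norm (e (of_real c)) * B" for c
      using Suc.prems(2)[of "Suc j" "\<omega> * c"] by (auto simp: norm_mult intro!: mult_left_mono)
    have "norm (integral {a..b} (\<lambda>x. e (of_real x) * of_real (H j (\<omega> * x)))) =
       norm (e (of_real b) * of_real (H (Suc j) (\<omega> * b)) - e (of_real a) * of_real (H (Suc j) (\<omega> * a)) - ?I) / \<omega>"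
      using ab(2) by (subst oscillatory_integration_by_parts[OF ab Suc.prems(1) H Hc])
         (simp add: norm_divide)
    also have "\<dots> \<le> (norm (e (of_real b)) * B + norm (e (of_real a)) * B + norm ?I) / \<omega>"
      using ab(2) b1[of a] b1[of b] by (intro divide_right_mono order_trans[OF norm_triangle_ineq4] add_mono) auto
    also have "\<dots> \<le> (B * ?E 0 + ((\<Sum>k<N. B / \<omega> ^ Suc k * ?E (Suc k)) + B * D * (b - a) / \<omega> ^ N)) / \<omega>"
      using IH ab(2) by (intro divide_right_mono) (auto simp: algebra_simps)
    also have "\<dots> = B / \<omega> ^ Suc 0 * ?E 0 + (\<Sum>k<N. B / \<omega> ^ Suc (Suc k) * ?E (Suc k)) + B * D * (b - a) / \<omega> ^ Suc N"
      by (simp add: add_divide_distrib sum_divide_distrib mult_ac)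
    also have "\<dots> = (\<Sum>k<Suc N. B / \<omega> ^ Suc k * ?E k) + B * D * (b - a) / \<omega> ^ Suc N"
      by (subst sum.lessThan_Suc_shift) simp
    finally show ?case .
  }
qed

section \<open>Periodic functions of mean zero\<close>

lemma periodic_continuous_bounded:
  fixes h :: "real \<Rightarrow> real"
  assumes "P > 0" "continuous_on UNIV h" "\<And>t. h (t + P) = h t"
  shows "\<exists>B. \<forall>t. \<bar>h t\<bar> \<le> B"
proof -
  interpret periodic_fun_simple h P by standard (rule assms)
  have "compact (h ` {0..P})"
    by (intro compact_continuous_image continuous_on_subset[OF assms(2)]) auto
  then obtain B where B: "\<And>t. t \<in> {0..P} \<Longrightarrow> \<bar>h t\<bar> \<le> B"
    by (force dest!: compact_imp_bounded simp: bounded_iff)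
  have "\<bar>h t\<bar> \<le> B" for t
  proof -
    have "h t = h (t - of_int \<lfloor>t / P\<rfloor> * P)" by (rule minus_of_int[symmetric])
    moreover have "t - of_int \<lfloor>t / P\<rfloor> * P \<in> {0..P}"
      using floor_divide_lower[OF \<open>P > 0\<close>, of t] floor_divide_upper[OF \<open>P > 0\<close>, of t]
      by (simp add: algebra_simps)
    ultimately show ?thesis using B by simp
  qed
  then show ?thesis by blast
qed

text \<open>Any antiderivative changes over one period by the integral of \<open>h\<close>, which is
  0, so it is periodic. Subtracting its mean restores mean zero, and the construction can be
  repeated.\<close>

lemma periodic_antiderivative:
  fixes h :: "real \<Rightarrow> real"
  assumes "P > 0" "continuous_on UNIV h" and per: "\<And>t. h (t + P) = h t"
    and int: "integral {0..P} h = 0"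
  obtains H where "\<And>t. (H has_real_derivative h t) (at t)" "\<And>t. H (t + P) = H t"
    "integral {0..P} H = 0"
proof -
  have "\<exists>F. \<forall>x::real. -\<infinity> < ereal x \<longrightarrow> ereal x < \<infinity> \<longrightarrow> (F has_vector_derivative h x) (at x)"
    by (rule einterval_antiderivative) (use assms(2) in \<open>auto simp: continuous_on_eq_continuous_at\<close>)
  then obtain F where F: "\<And>t. (F has_real_derivative h t) (at t)"
    by (auto simp: has_real_derivative_iff_has_vector_derivative)
  have Fc: "continuous_on UNIV F"
    using F by (meson DERIV_continuous_on has_field_derivative_at_within)
  have "((\<lambda>t. F (t + P) - F t) has_real_derivative 0) (at t)" for t
    using DERIV_diff[OF DERIV_shift[THEN iffD1, OF F[of "t + P"]] F[of t]] per by simp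
  then have const: "F (t + P) - F t = F (0 + P) - F 0" for t
    using DERIV_isconst_all[of "\<lambda>t. F (t + P) - F t" t 0] by blast
  have "(h has_integral F P - F 0) {0..P}"
    using \<open>P > 0\<close> F
    by (intro fundamental_theorem_of_calculus)
       (auto simp flip: has_real_derivative_iff_has_vector_derivative intro: has_field_derivative_at_within)
  then have "F P = F 0" using int by (simp add: integral_unique)
  then have Fp: "F (t + P) = F t" for t using const[of t] by simp
  define c where "c = integral {0..P} F / P"
  show thesis
  proof (rule that[of "\<lambda>t. F t - c"])
    show "((\<lambda>t. F t - c) has_real_derivative h t) (at t)" for t
      using F[of t] by (auto intro!: derivative_eq_intros)
    have "F integrable_on {0..P}"
      by (intro integrable_continuous_real continuous_on_subset[OF Fc]) auto
    then show "integral {0..P} (\<lambda>t. F t - c) = 0"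
      using \<open>P > 0\<close> by (subst integral_diff) (auto simp: c_def)
  qed (simp add: Fp)
qed

text \<open>Antiderivatives of mean zero are chosen one after another; each is continuous and
  periodic, hence bounded on the whole line.\<close>

lemma periodic_iterated_antiderivatives:
  fixes h :: "real \<Rightarrow> real"
  assumes "P > 0" "continuous_on UNIV h" "\<And>t. h (t + P) = h t" "integral {0..P} h = 0"
  obtains H :: "nat \<Rightarrow> real \<Rightarrow> real"
  where "H 0 = h" "\<And>j t. (H (Suc j) has_real_derivative H j t) (at t)"
    "\<And>j. \<exists>B. \<forall>t. \<bar>H j t\<bar> \<le> B"
proof -
  let ?Q = "\<lambda>u. continuous_on UNIV u \<and> (\<forall>t. u (t + P) = u t) \<and> integral {0..P} u = 0"
  have "\<exists>H. \<forall>j. (?Q (H j) \<and> (j = 0 \<longrightarrow> H j = h)) \<and> (\<forall>t. (H (Suc j) has_real_derivative H j t) (at t))"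
  proof (rule dependent_nat_choice)
    fix u :: "real \<Rightarrow> real" and j :: nat
    assume "?Q u \<and> (j = 0 \<longrightarrow> u = h)"
    then obtain v where "\<And>t. (v has_real_derivative u t) (at t)" "\<And>t. v (t + P) = v t" "integral {0..P} v = 0"
      using periodic_antiderivative[OF \<open>P > 0\<close>, of u] by metis
    moreover from this(1) have "continuous_on UNIV v"
      by (meson DERIV_continuous_on has_field_derivative_at_within)
    ultimately show "\<exists>v. (?Q v \<and> (Suc j = 0 \<longrightarrow> v = h)) \<and> (\<forall>t. (v has_real_derivative u t) (at t))"
      by auto
  qed (use assms in auto)
  then obtain H where H: "\<And>j. ?Q (H j)" "H 0 = h" "\<And>j t. (H (Suc j) has_real_derivative H j t) (at t)"
    by blast
  have "\<exists>B. \<forall>t. \<bar>H j t\<bar> \<le> B" for j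
    using H(1)[of j] by (intro periodic_continuous_bounded[OF \<open>P > 0\<close>]) auto
  with H that show thesis by blast
qed

section \<open>Moments of sine and cosine and the mean of \<open>g (phi t)\<close>\<close>

text \<open>Integrating the derivative of \<open>phi t ^ Suc m * psi t\<close> over a period, with
  \<open>psi\<close> the derivative of \<open>phi\<close>, shows that the moment of order
  \<open>m + 2\<close> is \<open>(m + 1) / (m + 2)\<close> times that of order \<open>m\<close>. The
  orders 0 and 1 start the recursion.\<close>

lemma has_integral_power_of_trig:
  fixes phi :: "real \<Rightarrow> real"
  assumes "phi = sin \<or> phi = cos"
  shows "((\<lambda>t. phi t ^ m) has_integral
    (if even m then 2 * pi * fact m / ((fact (m div 2))^2 * 2 ^ m) else 0)) {0..2*pi}"
proof -
  \<comment> \<open>With \<open>psi = cos\<close> for the sine and \<open>psi = - sin\<close> for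
    the cosine, both cases obey the same identities.\<close>
  obtain psi :: "real \<Rightarrow> real"
    where d: "\<And>t. (phi has_real_derivative psi t) (at t)" "\<And>t. (psi has_real_derivative - phi t) (at t)"
      and sq: "\<And>t. psi t * psi t = 1 - phi t ^ 2" and p: "phi (2*pi) = phi 0" "psi (2*pi) = psi 0"
  proof (cases "phi = sin")
    case True
    show ?thesis
      by (rule that[of cos])
         (use True in \<open>auto intro!: derivative_eq_intros simp: cos_squared_eq simp flip: power2_eq_square\<close>)
  next
    case False
    then have "phi = cos" using assms by auto
    then show ?thesis
      by (intro that[of "\<lambda>t. - sin t"])
         (auto intro!: derivative_eq_intros simp: sin_squared_eq simp flip: power2_eq_square)
  qed
  have ftc: "(u has_integral (U (2*pi) - U 0)) {0..2*pi}"
    if "\<And>t. (U has_real_derivative u t) (at t)" for u U :: "real \<Rightarrow> real"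
    using that by (intro fundamental_theorem_of_calculus)
       (auto simp flip: has_real_derivative_iff_has_vector_derivative intro: has_field_derivative_at_within)
  show ?thesis
  proof (induction m rule: induct_nat_012)
    case 0
    show ?case using has_integral_const_real[of "1::real" 0 "2*pi"] by simp
  next
    case 1
    have "((\<lambda>t. - psi t) has_real_derivative phi t) (at t)" for t
      using DERIV_minus[OF d(2)[of t]] by simp
    from ftc[OF this] show ?case by (simp add: p)
  next
    case (ge2 m)
    let ?M = "if even m then 2 * pi * fact m / ((fact (m div 2))^2 * 2 ^ m) else 0 :: real"
    have "((\<lambda>t. phi t ^ Suc m * psi t) has_real_derivative
        (real m + 1) * phi t ^ m - (real m + 2) * phi t ^ Suc (Suc m)) (at t)" for t
    proof -
      have "((\<lambda>t. phi t ^ Suc m * psi t) has_real_derivative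
        (real (Suc m) * (phi t ^ m * psi t)) * psi t + (- phi t) * phi t ^ Suc m) (at t)"
        using DERIV_mult[OF DERIV_power[OF d(1)[of t], of "Suc m"] d(2)[of t]] by (simp add: mult_ac)
      also have "(real (Suc m) * (phi t ^ m * psi t)) * psi t = real (Suc m) * phi t ^ m * (psi t * psi t)"
        by simp
      finally show ?thesis unfolding sq by (simp add: algebra_simps power2_eq_square)
    qed
    from ftc[OF this]
    have "((\<lambda>t. (real m + 1) * phi t ^ m - (real m + 2) * phi t ^ Suc (Suc m)) has_integral 0) {0..2*pi}"
      by (simp add: p)
    from has_integral_diff[OF has_integral_mult_right[OF ge2(1), of "real m + 1"] this]
    have "((\<lambda>t. (real m + 2) * phi t ^ Suc (Suc m)) has_integral (real m + 1) * ?M) {0..2*pi}"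
      by simp
    from has_integral_mult_right[OF this, of "1 / (real m + 2)"]
    have "((\<lambda>t. phi t ^ Suc (Suc m)) has_integral (real m + 1) * ?M / (real m + 2)) {0..2*pi}"
      by simp
    moreover have "(real m + 1) * ?M / (real m + 2) =
        (if even (Suc (Suc m)) then 2 * pi * fact (Suc (Suc m)) /
           ((fact (Suc (Suc m) div 2))^2 * 2 ^ Suc (Suc m)) else 0)"
    proof (cases "even m")
      case True
      then obtain k where "m = 2 * k" by blast
      then show ?thesis by (simp add: divide_simps power2_eq_square) (simp add: algebra_simps)
    qed simp
    ultimately show ?case by simp
  qed
qed

text \<open>Along the real axis the complex derivative is the vector derivative of a real-valued
  function: its real part is the real derivative and its imaginary part is 0. This turns the
  derivatives of \<open>g\<close> in \<open>rho0\<close> into Taylor coefficients of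
  \<open>G\<close>.\<close>

lemma higher_deriv_real_restriction:
  fixes g :: "real \<Rightarrow> real"
  assumes "open S" "G holomorphic_on S" "open I" "complex_of_real ` I \<subseteq> S"
    and "\<And>t. t \<in> I \<Longrightarrow> G (of_real t) = of_real (g t)" "t \<in> I"
  shows "(deriv ^^ m) G (of_real t) = of_real ((deriv ^^ m) g t)"
  using \<open>t \<in> I\<close>
proof (induction m arbitrary: t)
  case (Suc m)
  have "((deriv ^^ m) G has_field_derivative (deriv ^^ Suc m) G (of_real t)) (at (of_real t))"
    using assms Suc.prems by (auto intro!: holomorphic_derivI holomorphic_higher_deriv)
  then have "((\<lambda>t. (deriv ^^ m) G (of_real t)) has_vector_derivative (deriv ^^ Suc m) G (of_real t)) (at t)"
    using has_vector_derivative_real_field by blast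
  then have v: "((\<lambda>t. complex_of_real ((deriv ^^ m) g t)) has_vector_derivative (deriv ^^ Suc m) G (of_real t)) (at t)"
    by (rule has_vector_derivative_transform_within_open[OF _ \<open>open I\<close> Suc.prems]) (use Suc.IH in auto)
  have "((\<lambda>t. Re (complex_of_real ((deriv ^^ m) g t)))
      has_vector_derivative Re ((deriv ^^ Suc m) G (of_real t))) (at t)"
    using bounded_linear.has_vector_derivative[OF bounded_linear_Re v] .
  then have "deriv ((deriv ^^ m) g) t = Re ((deriv ^^ Suc m) G (of_real t))"
    by (intro DERIV_imp_deriv) (simp add: has_real_derivative_iff_has_vector_derivative)
  moreover have "((\<lambda>t. Im (complex_of_real ((deriv ^^ m) g t)))
      has_vector_derivative Im ((deriv ^^ Suc m) G (of_real t))) (at t)"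
    using bounded_linear.has_vector_derivative[OF bounded_linear_Im v] .
  then have "Im ((deriv ^^ Suc m) G (of_real t)) = 0"
    using vector_derivative_unique_at[OF _ has_vector_derivative_const] by fastforce
  ultimately show ?case by (simp add: complex_eq_iff)
qed (use assms in auto)

text \<open>Termwise integration of the Taylor series of \<open>g\<close>: the factor \<open>(k!)\<^sup>2 4^k\<close> in \<^const>\<open>rho0\<close> comes
  from the even moments of the sine.\<close>

lemma has_integral_compose_trig:
  fixes g phi :: "real \<Rightarrow> real"
  assumes r: "r > 1" and G_hol: "G holomorphic_on ball 0 r"
    and G_ext: "\<forall>t\<in>{-1..1}. G (complex_of_real t) = complex_of_real (g t)"
    and phi: "phi = sin \<or> phi = cos"
  shows "((\<lambda>t. g (phi t)) has_integral pi * rho0 g) {0..2*pi}"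
proof -
  define c where "c m = (deriv ^^ m) g 0 / fact m" for m
  have dG: "(deriv ^^ m) G 0 = of_real ((deriv ^^ m) g 0)" for m
    using higher_deriv_real_restriction[OF _ G_hol, of "{-1<..<1}" g 0 m] G_ext r by force
  have ser: "(\<lambda>m. of_real (c m) * z ^ m) sums G z" if "norm z < r" for z
    using holomorphic_power_series[OF G_hol, of z] that by (simp add: dG c_def)
  have gser: "(\<lambda>m. c m * t ^ m) sums g t" if "t \<in> {-1..1}" for t
  proof -
    have "\<bar>t\<bar> < r" using that r by auto
    then have "(\<lambda>m. of_real (c m * t ^ m)) sums complex_of_real (g t)"
      using ser[of "of_real t"] that G_ext by simp
    then show ?thesis by (simp only: sums_of_real_iff)
  qed
  \<comment> \<open>Convergence at some \<open>s > 1\<close> makes the coefficients absolutely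
    summable. They then serve as majorant in the Weierstrass test, because \<open>phi\<close> takes
    values in [-1, 1].\<close>
  obtain s where s: "1 < s" "s < r" using r dense by blast
  have "summable (\<lambda>m. of_real (c m) * complex_of_real s ^ m)"
    using ser[of "of_real s"] s by (simp add: sums_iff)
  then have "summable (\<lambda>m. norm (of_real (c m) * (1::complex) ^ m))"
    by (rule powser_insidea) (use s in auto)
  then have abs: "summable (\<lambda>m. \<bar>c m\<bar>)" by simp
  have phi1: "phi t \<in> {-1..1}" for t using phi by auto
  have phic: "continuous_on A phi" for A using phi by (auto intro: continuous_intros)
  have "uniform_limit {0..2*pi} (\<lambda>N t. \<Sum>m<N. c m * phi t ^ m) (\<lambda>t. \<Sum>m. c m * phi t ^ m) sequentially"
  proof (rule Weierstrass_m_test[OF _ abs])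
    fix m t
    have "\<bar>phi t\<bar> ^ m \<le> 1" using phi1[of t] by (intro power_le_one) auto
    then show "norm (c m * phi t ^ m) \<le> \<bar>c m\<bar>"
      by (simp add: abs_mult power_abs mult_left_le)
  qed
  also have "(\<lambda>t. \<Sum>m. c m * phi t ^ m) = (\<lambda>t. g (phi t))"
    using gser[OF phi1] by (simp add: sums_iff)
  finally obtain I J where IJ: "\<And>N. ((\<lambda>t. \<Sum>m<N. c m * phi t ^ m) has_integral I N) {0..2*pi}"
      "((\<lambda>t. g (phi t)) has_integral J) {0..2*pi}" "I \<longlonglongrightarrow> J"
    by (rule uniform_limit_integral) (auto intro!: continuous_intros phic)
  define \<mu> where "\<mu> m = (if even m then 2 * pi * fact m / ((fact (m div 2))^2 * 2 ^ m) else 0 :: real)" for m :: nat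
  have "((\<lambda>t. \<Sum>m<N. c m * phi t ^ m) has_integral (\<Sum>m<N. c m * \<mu> m)) {0..2*pi}" for N
    unfolding \<mu>_def by (intro has_integral_sum has_integral_mult_right has_integral_power_of_trig phi) auto
  then have "I = (\<lambda>N. \<Sum>m<N. c m * \<mu> m)"
    using IJ(1) has_integral_unique by blast
  with IJ(3) have "(\<lambda>m. c m * \<mu> m) sums J" by (simp add: sums_def)
  \<comment> \<open>The odd moments vanish, so only the terms of even index remain.\<close>
  then have "(\<lambda>k. c (2 * k) * \<mu> (2 * k)) sums J"
    by (subst sums_mono_reindex[of "\<lambda>k. 2 * k"]) (auto simp: strict_mono_def \<mu>_def)
  also have "(\<lambda>k. c (2 * k) * \<mu> (2 * k)) = (\<lambda>k. 2 * pi * ((deriv ^^ (2*k)) g 0 / ((fact k)^2 * 4^k)))"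
    by (simp add: c_def \<mu>_def power_mult) (simp add: mult_ac)
  finally have "(\<lambda>k. (deriv ^^ (2*k)) g 0 / ((fact k)^2 * 4^k)) sums (J / (2 * pi))"
    by (rule sums_mult_D) simp
  then have "J = pi * rho0 g" by (simp add: rho0_def sums_iff)
  with IJ(2) show ?thesis by simp
qed

section \<open>The quadrature error\<close>

lemma compact_of_real_image_Icc: "compact (complex_of_real ` {a..b})"
  by (intro compact_continuous_image continuous_intros) auto

lemma convex_of_real_image_Icc: "convex (complex_of_real ` {a..b})"
  by (intro convex_linear_image linearI) (auto simp: scaleR_conv_of_real)

text \<open>Closed discs of one common radius around the points of \<open>K\<close> fit into
  \<open>S\<close>. Their union is compact as a Minkowski sum, so \<open>f\<close> is bounded on
  it.\<close>

lemma holomorphic_bounded_thickening: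
  assumes "compact K" "open S" "K \<subseteq> S" "f holomorphic_on S"
  obtains d M where "d > 0" "thickening K d \<subseteq> S" "\<And>z. z \<in> thickening K d \<Longrightarrow> norm (f z) \<le> M"
proof -
  obtain d where d: "d > 0" "(\<Union>c\<in>K. cball c d) \<subseteq> S"
    using compact_subset_open_imp_cball_epsilon_subset[OF assms(1-3)] by blast
  have "(\<Union>c\<in>K. cball c d) = (\<Union>c\<in>K. \<Union>y\<in>cball 0 d. {c + y})"
  proof -
    have "z \<in> cball c d \<longleftrightarrow> (\<exists>y\<in>cball 0 d. z = c + y)" for c z :: complex
      by (auto simp: dist_norm norm_minus_commute intro!: bexI[of _ "z - c"])
    then show ?thesis by blast
  qed
  then have "compact (\<Union>c\<in>K. cball c d)"
    using compact_sums'[OF assms(1) compact_cball] by simp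
  then have "compact (f ` (\<Union>c\<in>K. cball c d))"
    using continuous_on_subset[OF holomorphic_on_imp_continuous_on[OF assms(4)] d(2)]
    by (rule compact_continuous_image[rotated])
  then obtain M where "\<And>z. z \<in> (\<Union>c\<in>K. cball c d) \<Longrightarrow> norm (f z) \<le> M"
    by (force dest!: compact_imp_bounded simp: bounded_iff)
  moreover have "thickening K d \<subseteq> (\<Union>c\<in>K. cball c d)"
    unfolding thickening_def using ball_subset_cball by blast
  ultimately show thesis using d by (intro that[of d M]) blast+
qed

text \<open>Factors with index in \<open>J\<close> are bounded by \<open>s\<close>, the others by
  \<open>L\<close>. Taking for \<open>J\<close> the nodes near an endpoint extracts the smallness;
  an empty \<open>J\<close> gives the crude bound.\<close>

lemma norm_prod_cluster_le:
  fixes y :: "nat \<Rightarrow> complex"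
  assumes "J \<subseteq> {..<n}" "\<And>k. k \<in> J \<Longrightarrow> norm (z - y k) \<le> s" "\<And>k. k < n \<Longrightarrow> norm (z - y k) \<le> L"
  shows "norm (\<Prod>k<n. z - y k) \<le> s ^ card J * L ^ (n - card J)"
proof -
  have J: "finite J" using assms(1) finite_subset by blast
  have "norm (\<Prod>k<n. z - y k) = (\<Prod>k\<in>{..<n} - J. norm (z - y k)) * (\<Prod>k\<in>J. norm (z - y k))"
    by (simp add: prod_norm norm_mult prod.subset_diff[OF assms(1)])
  also have "\<dots> \<le> (\<Prod>k\<in>{..<n} - J. L) * (\<Prod>k\<in>J. s)"
  proof (rule mult_mono)
    \<comment> \<open>If an index is left, \<open>L\<close> bounds a norm and is nonnegative;
      otherwise the product is 1.\<close>
    show "0 \<le> (\<Prod>k\<in>{..<n} - J. L)"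
      using assms(3) by (intro prod_nonneg) (meson DiffD1 lessThan_iff norm_ge_zero order_trans)
  next
    show "(\<Prod>k\<in>{..<n} - J. norm (z - y k)) \<le> (\<Prod>k\<in>{..<n} - J. L)"
      by (rule prod_mono) (use assms(3) in auto)
    show "(\<Prod>k\<in>J. norm (z - y k)) \<le> (\<Prod>k\<in>J. s)"
      by (rule prod_mono) (use assms(2) in auto)
  qed (auto intro!: prod_nonneg)
  also have "\<dots> = s ^ card J * L ^ (n - card J)"
    using assms(1) J by (simp add: card_Diff_subset)
  finally show ?thesis .
qed

text \<open>Cauchy's inequality on discs of radius \<open>1 / \<omega>\<close> around the endpoints turns the smallness of \<open>e\<close>
  there into bounds \<open>O(\<omega>^(k - n))\<close> for the \<open>k\<close>-th derivative, which the factor \<open>\<omega>^(-k-1)\<close> of the \<open>k\<close>-th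
  boundary term exactly compensates.\<close>

lemma oscillatory_integral_bound_endpoint_decay:
  fixes H :: "nat \<Rightarrow> real \<Rightarrow> real"
  assumes ab: "a \<le> b" and \<omega>: "\<omega> > 0" and d: "1 / \<omega> < d"
    and e: "e holomorphic_on thickening (of_real ` {a..b}) d"
    and M: "\<And>z. z \<in> thickening (of_real ` {a..b}) d \<Longrightarrow> norm (e z) \<le> M"
    and E: "\<And>c z. c \<in> {a, b} \<Longrightarrow> norm (of_real c - z) \<le> 1 / \<omega> \<Longrightarrow> norm (e z) \<le> E / \<omega> ^ n"
    and H: "\<And>j t. (H (Suc j) has_real_derivative H j t) (at t)" and H0: "continuous_on UNIV (H 0)"
    and B: "\<And>i t. i \<le> Suc n \<Longrightarrow> \<bar>H i t\<bar> \<le> B"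
  shows "norm (integral {a..b} (\<lambda>x. e (of_real x) * of_real (H 0 (\<omega> * x)))) \<le>
    ((\<Sum>k<Suc n. 2 * B * fact k * E) + B * (fact (Suc n) * M / (d / 2) ^ Suc n) * (b - a)) / \<omega> ^ Suc n"
proof -
  let ?K = "complex_of_real ` {a..b}"
  have "0 < 1 / \<omega>" using \<omega> by simp
  then have d0: "d > 0" using d by linarith
  have B0: "B \<ge> 0" using B[of 0 0] by linarith
  have K: "?K \<subseteq> thickening ?K u" if "u > 0" for u
    unfolding thickening_def using that centre_in_ball by blast
  have end_deriv: "norm ((deriv ^^ k) e (of_real c)) \<le> fact k * (E / \<omega> ^ n) / (1 / \<omega>) ^ k"
    if c: "c \<in> {a, b}" for c k
  proof -
    have sub: "cball (of_real c) (1 / \<omega>) \<subseteq> thickening ?K d"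
      using c ab d unfolding thickening_def by (auto intro!: bexI[of _ c])
    then have hb: "e holomorphic_on cball (of_real c) (1 / \<omega>)" by (rule holomorphic_on_subset[OF e])
    show ?thesis
    proof (rule Cauchy_inequality)
      show "e holomorphic_on ball (of_real c) (1 / \<omega>)" by (rule holomorphic_on_subset[OF hb]) auto
      show "continuous_on (cball (of_real c) (1 / \<omega>)) e" using hb by (rule holomorphic_on_imp_continuous_on)
    qed (use \<omega> E[OF c] in auto)
  qed
  \<comment> \<open>The Cauchy discs here have radius \<open>d / 2\<close> instead of
    \<open>1 / \<omega>\<close>, so this bound carries no power of \<omega>.\<close>
  have "norm ((deriv ^^ Suc n) e (of_real x)) \<le> fact (Suc n) * M / (d / 2) ^ Suc n" if "x \<in> {a..b}" for x
    by (rule holomorphic_on_thickening_deriv_bound[of e ?K "d / 2" "d / 2"])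
       (use d0 e M K[of "d / 2"] that in auto)
  from oscillatory_integral_bound[OF ab \<omega> open_thickening K[OF d0] e H H0 _ this, where j = 0 and B = B] B
  have "norm (integral {a..b} (\<lambda>x. e (of_real x) * of_real (H 0 (\<omega> * x)))) \<le>
    (\<Sum>k<Suc n. B / \<omega> ^ Suc k * (norm ((deriv ^^ k) e (of_real a)) + norm ((deriv ^^ k) e (of_real b))))
    + B * (fact (Suc n) * M / (d / 2) ^ Suc n) * (b - a) / \<omega> ^ Suc n"
    by simp
  also have "(\<Sum>k<Suc n. B / \<omega> ^ Suc k * (norm ((deriv ^^ k) e (of_real a)) + norm ((deriv ^^ k) e (of_real b))))
    \<le> (\<Sum>k<Suc n. 2 * B * fact k * E / \<omega> ^ Suc n)"
  proof (rule sum_mono)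
    fix k
    have "B / \<omega> ^ Suc k * (norm ((deriv ^^ k) e (of_real a)) + norm ((deriv ^^ k) e (of_real b)))
      \<le> B / \<omega> ^ Suc k * (2 * (fact k * (E / \<omega> ^ n) / (1 / \<omega>) ^ k))"
    proof (rule mult_left_mono)
      show "norm ((deriv ^^ k) e (of_real a)) + norm ((deriv ^^ k) e (of_real b))
        \<le> 2 * (fact k * (E / \<omega> ^ n) / (1 / \<omega>) ^ k)"
        using add_mono[OF end_deriv[of a k] end_deriv[of b k]] by (simp add: mult_ac)
    qed (use B0 \<omega> in auto)
    also have "\<dots> = 2 * B * fact k * E / \<omega> ^ Suc n"
      using \<omega> by (simp add: field_simps)
    finally show "B / \<omega> ^ Suc k * (norm ((deriv ^^ k) e (of_real a)) + norm ((deriv ^^ k) e (of_real b)))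
      \<le> 2 * B * fact k * E / \<omega> ^ Suc n" .
  qed
  finally show ?thesis by (simp add: add_divide_distrib sum_divide_distrib)
qed

section \<open>Assembling the error estimate\<close>

lemma IO_add:
  assumes "continuous_on {a..b} (\<lambda>x. u (of_real x))" "continuous_on {a..b} (\<lambda>x. v (of_real x))"
    and "continuous_on UNIV (\<lambda>t. g (phi t))"
  shows "IO g phi a b \<omega> (\<lambda>z. u z + v z) = IO g phi a b \<omega> u + IO g phi a b \<omega> v"
proof -
  have "continuous_on {a..b} (\<lambda>x. g (phi (\<omega> * x)))"
    by (rule continuous_on_compose2[OF assms(3)]) (auto intro: continuous_intros)
  then show ?thesis
    unfolding IO_def ring_distribs
    by (intro integral_add integrable_continuous_real continuous_intros assms)
qed

text \<open>Running \<open>i mod n\<close> over \<open>i < 2 * n\<close> lists every node exactly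
  twice. Doubled nodes enter the interpolation lemma in this form.\<close>

lemma prod_double_period:
  fixes y :: "nat \<Rightarrow> 'a::comm_monoid_mult"
  shows "(\<Prod>i<2 * n. y (i mod n)) = (\<Prod>k<n. y k) ^ 2"
proof -
  have "(\<Prod>i<2 * n. y (i mod n)) = (\<Prod>m<2. \<Prod>i\<in>{m * n..<m * n + n}. y (i mod n))"
    by (rule prod.nat_group[symmetric])
  also have "\<dots> = (\<Prod>m<(2::nat). \<Prod>k<n. y k)"
  proof (rule prod.cong[OF refl])
    fix m :: nat
    show "(\<Prod>i\<in>{m * n..<m * n + n}. y (i mod n)) = (\<Prod>k<n. y k)"
      using prod.shift_bounds_nat_ivl[of "\<lambda>i. y (i mod n)" 0 "m * n" n]
      by (simp add: add.commute lessThan_atLeast0)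
  qed
  finally show ?thesis by simp
qed

text \<open>\<open>G\<close> is the analytic continuation of \<open>g\<close>, kept apart because
  \<open>rho0\<close> and \<open>IO\<close> take the real function. The two groups of nodes are the
  indices below \<open>n div 2\<close> and the remaining ones. Nodes may lie outside
  \<open>S\<close> for small \<omega>, which does not affect the asymptotic estimate.\<close>

theorem theorem3p1:
  fixes a b r :: real and g phi :: "real \<Rightarrow> real" and G :: "complex \<Rightarrow> complex"
    and n :: nat
    and q :: "real \<Rightarrow> complex poly"
    and x w :: "real \<Rightarrow> nat \<Rightarrow> complex"
  assumes ab: "a < b"
    and r: "r > 1"
    and g_nonneg: "\<forall>t\<in>{-1..1}. g t \<ge> 0"
    and G_hol: "G holomorphic_on ball 0 r"
    and G_ext: "\<forall>t\<in>{-1..1}. G (complex_of_real t) = complex_of_real (g t)"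
    and phi: "phi = sin \<or> phi = cos"
    and n: "n > 0" "even n"
    and gauss: "eventually (\<lambda>\<omega>.
          lead_coeff (q \<omega>) = 1 \<and> degree (q \<omega>) = n
        \<and> (\<forall>j<n. IO g phi a b \<omega> (\<lambda>z. poly (q \<omega>) z * z ^ j) = 0)
        \<and> {z. poly (q \<omega>) z = 0} = x \<omega> ` {..<n}
        \<and> inj_on (x \<omega>) {..<n}
        \<and> (\<forall>p::complex poly. degree p \<le> 2*n - 1 \<longrightarrow>
              (\<Sum>k<n. w \<omega> k * poly p (x \<omega> k)) = IO g phi a b \<omega> (poly p))) at_top"
    and near_a: "\<forall>k<n div 2. (\<lambda>\<omega>. norm (x \<omega> k - complex_of_real a)) \<in> O[at_top](\<lambda>\<omega>. 1 / \<omega>)"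
    and near_b: "\<forall>k\<in>{n div 2..<n}. (\<lambda>\<omega>. norm (x \<omega> k - complex_of_real b)) \<in> O[at_top](\<lambda>\<omega>. 1 / \<omega>)"
  shows "\<forall>(f :: complex \<Rightarrow> complex) S. open S \<and> complex_of_real ` {a..b} \<subseteq> S \<and> f holomorphic_on S \<longrightarrow>
     (\<lambda>\<omega>. norm (IO g phi a b \<omega> f - (\<Sum>k<n. w \<omega> k * f (x \<omega> k))))
        \<in> O[at_top](\<lambda>\<omega>. \<omega> powr (- real n - 1))"
proof (intro allI impI, elim conjE)
  fix f :: "complex \<Rightarrow> complex" and S
  assume S: "open S" "complex_of_real ` {a..b} \<subseteq> S" "f holomorphic_on S"
  let ?K = "complex_of_real ` {a..b}"
  have gphi: "continuous_on UNIV (\<lambda>t. g (phi t))"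
  proof -
    have phi1: "phi t \<in> {-1..1}" for t using phi by auto
    have "continuous_on {-1..1} (\<lambda>t. Re (G (of_real t)))"
      by (intro continuous_intros continuous_on_compose2[OF holomorphic_on_imp_continuous_on[OF G_hol]])
         (use r in auto)
    then have "continuous_on {-1..1} g"
      by (rule continuous_on_eq) (use G_ext in simp)
    then show ?thesis
      by (rule continuous_on_compose2) (use phi phi1 in \<open>auto intro: continuous_intros\<close>)
  qed
  define h where "h t = g (phi t) - rho0 g / 2" for t
  have hc: "continuous_on UNIV h" unfolding h_def by (intro continuous_intros gphi)
  have hp: "h (t + 2 * pi) = h t" for t using phi by (auto simp: h_def)
  \<comment> \<open>Over a period of length \<open>2 * pi\<close> the constant
    \<open>rho0 g / 2\<close> integrates to \<open>pi * rho0 g\<close>, which cancels the integral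
    of \<open>g (phi t)\<close>.\<close>
  have "(h has_integral pi * rho0 g - (2 * pi - 0) *\<^sub>R (rho0 g / 2)) {0..2*pi}"
    unfolding h_def
    using has_integral_diff[OF has_integral_compose_trig[OF r G_hol G_ext phi] has_integral_const_real[of "rho0 g / 2" 0 "2*pi"]]
    by simp
  then have hi: "integral {0..2*pi} h = 0" by (simp add: integral_unique)
  obtain H where H: "H 0 = h" "\<And>j t. (H (Suc j) has_real_derivative H j t) (at t)"
    "\<And>j. \<exists>B. \<forall>t. \<bar>H j t\<bar> \<le> B"
    using periodic_iterated_antiderivatives[OF _ hc hp hi] by auto
  obtain B0 where B0: "\<And>j t. \<bar>H j t\<bar> \<le> B0 j" using H(3) by metis
  \<comment> \<open>A common bound for the \<open>n + 2\<close> functions \<open>H 0\<close> to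
    \<open>H (Suc n)\<close> that occur in \<open>n + 1\<close> integrations by parts.\<close>
  define B where "B = (\<Sum>j\<le>Suc n. B0 j)"
  have B: "\<bar>H i t\<bar> \<le> B" if "i \<le> Suc n" for i t
  proof -
    have "B0 i \<le> B" unfolding B_def
      using that B0 by (intro member_le_sum) (auto intro: order_trans[OF abs_ge_zero])
    with B0[of i t] show ?thesis by simp
  qed
  obtain \<delta> M where \<delta>: "\<delta> > 0" "thickening ?K \<delta> \<subseteq> S" "\<And>z. z \<in> thickening ?K \<delta> \<Longrightarrow> norm (f z) \<le> M"
    by (rule holomorphic_bounded_thickening[OF compact_of_real_image_Icc S]) blast
  \<comment> \<open>Half of \<delta> is kept for the nodes and the remainder; the other half pays
    for \<open>2 * n\<close> divisions at a cost of \<eta> each.\<close>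
  define d where "d = \<delta> / 2"
  define \<eta> where "\<eta> = \<delta> / (4 * real n)"
  have d: "d > 0" "\<eta> > 0" "d + real (2 * n) * \<eta> = \<delta>"
    using \<delta>(1) n(1) by (auto simp: d_def \<eta>_def field_simps)
  \<comment> \<open>\<open>C\<close> bounds every remainder \<open>R\<close>, and \<open>L\<close>
    bounds the distance from a point to a node once the nodes lie in \<open>thickening ?K d\<close>.
    Neither depends on \<omega>.\<close>
  define C where "C = M / \<eta> ^ (2 * n)"
  define L where "L = diameter (thickening ?K d)"
  have bdd: "bounded (thickening ?K d)"
    unfolding thickening_eq_sums
    by (intro bounded_sums) (auto intro!: compact_imp_bounded compact_of_real_image_Icc)
  have L: "norm (z - y) \<le> L" if "z \<in> thickening ?K d" "y \<in> thickening ?K d" for z y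
    using diameter_bounded_bound[OF bdd that] by (simp add: L_def dist_norm)
  define c where "c k = (if k < n div 2 then a else b)" for k
  \<comment> \<open>Summing over the nodes merges the separate asymptotic constants into a single
    \<open>A\<close>.\<close>
  have "(\<lambda>\<omega>. \<Sum>k<n. norm (x \<omega> k - of_real (c k))) \<in> O[at_top](\<lambda>\<omega>. 1 / \<omega>)"
    using near_a near_b by (intro big_sum_in_bigo) (auto simp: c_def)
  then obtain A where A: "A > 0"
      "eventually (\<lambda>\<omega>. norm (\<Sum>k<n. norm (x \<omega> k - of_real (c k))) \<le> A * norm (1 / \<omega>)) at_top"
    by (rule landau_o.bigE)
  \<comment> \<open>Within \<open>1 / \<omega>\<close> of an endpoint, \<open>W\<close> has
    \<open>n div 2\<close> factors of size at most \<open>(1 + A) / \<omega>\<close> and as many of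
    size at most \<open>L\<close>. Squaring and multiplying by \<open>C\<close> gives
    \<open>E / \<omega> ^ n\<close>.\<close>
  define E where "E = ((1 + A) * L) ^ n * C"
  define Z where "Z = (\<Sum>k<Suc n. 2 * B * fact k * E) + B * (fact (Suc n) * (L ^ (2 * n) * C) / (d / 2) ^ Suc n) * (b - a)"
  \<comment> \<open>The threshold \<open>(1 + A) / d\<close> keeps the nodes and the discs of radius
    \<open>1 / \<omega>\<close> about the endpoints inside \<open>thickening ?K d\<close>.\<close>
  have "eventually (\<lambda>\<omega>. norm (IO g phi a b \<omega> f - (\<Sum>k<n. w \<omega> k * f (x \<omega> k))) \<le> Z / \<omega> ^ Suc n) at_top"
    using gauss A(2) eventually_gt_at_top[of 0] eventually_gt_at_top[of "(1 + A) / d"]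
  proof eventually_elim
    case (elim \<omega>)
    note \<omega> = elim(3)
    let ?y = "x \<omega>"
    have near: "norm (?y k - of_real (c k)) \<le> A / \<omega>" if "k < n" for k
    proof -
      have "norm (?y k - of_real (c k)) \<le> (\<Sum>k<n. norm (?y k - of_real (c k)))"
        using that by (intro member_le_sum) auto
      also have "\<dots> \<le> A / \<omega>" using elim(2) \<omega> by (simp add: sum_nonneg)
      finally show ?thesis .
    qed
    have Ad: "(1 + A) / \<omega> < d" using elim(4) \<omega> d(1) by (simp add: field_simps)
    then have d1: "1 / \<omega> < d" and dA: "A / \<omega> < d"
      using A(1) \<omega> by (simp_all add: add_divide_distrib) (smt (verit) divide_pos_pos)+
    have c_in: "of_real (c k) \<in> ?K" for k using ab by (auto simp: c_def)
    have y_in: "?y k \<in> thickening ?K d" if "k < n" for k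
      using c_in[of k] near[OF that] dA unfolding thickening_def
      by (intro UN_I[of "of_real (c k)"]) (auto simp: dist_norm norm_minus_commute)
    \<comment> \<open>Both \<open>p\<close> and \<open>R\<close> depend on \<omega>, but
      \<open>C\<close> does not. With \<open>2 * n\<close> nodes counted twice over, the degree of
      \<open>p\<close> just fits the exactness of the rule.\<close>
    obtain p R where p: "\<forall>i\<ge>2 * n. coeff p i = 0" and R: "R holomorphic_on thickening ?K d"
      "\<forall>z\<in>thickening ?K d. norm (R z) \<le> C"
      and f: "\<forall>z. f z = poly p z + (\<Prod>i<2 * n. z - ?y (i mod n)) * R z"
      using holomorphic_interpolation_remainder[OF convex_of_real_image_Icc[of a b] d(2),
          of f d "2 * n" M "\<lambda>i. ?y (i mod n)"]
        holomorphic_on_subset[OF S(3) \<delta>(2)] \<delta>(3) y_in n(1) unfolding d(3) C_def by auto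
    define W where "W z = (\<Prod>k<n. z - ?y k)" for z
    define e where "e z = W z ^ 2 * R z" for z
    have f_eq: "f = (\<lambda>z. poly p z + e z)"
      using f prod_double_period[of "\<lambda>k. _ - ?y k" n] by (simp add: fun_eq_iff e_def W_def)
    have e_hol: "e holomorphic_on thickening ?K d"
      unfolding e_def W_def by (intro holomorphic_intros R)
    have C0: "C \<ge> 0" using R(2) y_in[OF n(1)] by (meson norm_ge_zero order_trans)
    have "of_real (c 0) \<in> thickening ?K d"
      using c_in[of 0] d(1) unfolding thickening_def by (intro UN_I[of "of_real (c 0)"]) auto
    then have L0: "L \<ge> 0" using L by (meson norm_ge_zero order_trans)
    have e_bd: "norm (e z) \<le> L ^ (2 * n) * C" if "z \<in> thickening ?K d" for z
    proof -
      have "norm (W z) \<le> L ^ n"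
        using norm_prod_cluster_le[of "{}" n z ?y L L] L[OF that y_in] by (simp add: W_def)
      then have "norm (W z) ^ 2 \<le> (L ^ n) ^ 2" by (intro power_mono) auto
      then show ?thesis using R(2) that C0 L0
        by (auto simp: e_def norm_mult norm_power power_mult mult.commute[of 2 n] intro!: mult_mono)
    qed
    have e_end: "norm (e z) \<le> E / \<omega> ^ n" if u: "u \<in> {a, b}" and z: "norm (of_real u - z) \<le> 1 / \<omega>" for u z
    proof -
      have zin: "z \<in> thickening ?K d"
        using u ab z d1 unfolding thickening_def by (intro UN_I[of "of_real u"]) (auto simp: dist_norm)
      \<comment> \<open>The nodes assigned to the endpoint \<open>u\<close>; since \<open>n\<close>
        is even, either half has \<open>n div 2\<close> elements.\<close>
      define J where "J = (if u = a then {..<n div 2} else {n div 2..<n})"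
      have J: "J \<subseteq> {..<n}" "card J = n div 2" "\<And>k. k \<in> J \<Longrightarrow> c k = u"
        using u n(2) by (auto simp: J_def c_def split: if_splits)
      have "norm (z - ?y k) \<le> (1 + A) / \<omega>" if "k \<in> J" for k
      proof -
        have "norm (z - ?y k) \<le> norm (of_real u - z) + norm (?y k - of_real u)"
          by norm
        then show ?thesis using z near[of k] J(1) J(3)[OF that] that by (auto simp: add_divide_distrib)
      qed
      then have "norm (W z) \<le> ((1 + A) / \<omega>) ^ (n div 2) * L ^ (n - n div 2)"
        using norm_prod_cluster_le[OF J(1), of z ?y "(1 + A) / \<omega>" L] L[OF zin y_in] by (simp add: W_def J(2))
      also have "n - n div 2 = n div 2" using n(2) by presburger
      also have "((1 + A) / \<omega>) ^ (n div 2) * L ^ (n div 2) = ((1 + A) / \<omega> * L) ^ (n div 2)"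
        by (rule power_mult_distrib[symmetric])
      finally have "norm (W z) ^ 2 \<le> (((1 + A) / \<omega> * L) ^ (n div 2)) ^ 2" by (intro power_mono) auto
      also have "\<dots> = ((1 + A) / \<omega> * L) ^ n" using n(2) by (simp flip: power_mult)
      finally have "norm (e z) \<le> ((1 + A) / \<omega> * L) ^ n * C"
        using R(2) zin C0 L0 A(1) \<omega> by (auto simp: e_def norm_mult norm_power intro!: mult_mono)
      then show ?thesis by (simp add: E_def power_divide)
    qed
    have "IO g phi a b \<omega> f = IO g phi a b \<omega> (poly p) + IO g phi a b \<omega> e"
      unfolding f_eq
    proof (rule IO_add)
      show "continuous_on {a..b} (\<lambda>x. e (of_real x))"
        using d(1) unfolding thickening_def
        by (intro continuous_on_compose2[OF holomorphic_on_imp_continuous_on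
              [OF e_hol, unfolded thickening_def]] continuous_intros)
           auto
    qed (intro continuous_intros gphi)+
    \<comment> \<open>\<open>W\<close> and hence \<open>e\<close> vanish at the nodes, so the rule
      does not distinguish \<open>f\<close> from \<open>p\<close>.\<close>
    moreover have "(\<Sum>k<n. w \<omega> k * f (?y k)) = (\<Sum>k<n. w \<omega> k * poly p (?y k))"
      by (intro sum.cong) (auto simp: f_eq e_def W_def)
    moreover have "degree p \<le> 2 * n - 1"
      using p n(1) by (intro degree_le) auto
    ultimately have "IO g phi a b \<omega> f - (\<Sum>k<n. w \<omega> k * f (?y k)) = IO g phi a b \<omega> e"
      using elim(1) by simp
    also have "\<dots> = integral {a..b} (\<lambda>x. e (of_real x) * of_real (H 0 (\<omega> * x)))"
      by (simp add: IO_def H(1) h_def)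
    also have "norm \<dots> \<le> Z / \<omega> ^ Suc n"
      unfolding Z_def
      by (rule oscillatory_integral_bound_endpoint_decay[where H = H])
         (use ab \<omega> d1 e_hol e_bd e_end H(2) B H(1) hc in auto)
    finally show ?case .
  qed
  with eventually_gt_at_top[of 0]
  have "eventually (\<lambda>\<omega>. norm (norm (IO g phi a b \<omega> f - (\<Sum>k<n. w \<omega> k * f (x \<omega> k))))
      \<le> Z * norm (\<omega> powr (- real n - 1))) at_top"
  proof eventually_elim
    case (elim \<omega>)
    have "- real n - 1 = - real (Suc n)" by simp
    then have "\<omega> powr (- real n - 1) = 1 / \<omega> ^ Suc n"
      using elim(1) by (simp only: powr_minus powr_realpow inverse_eq_divide)
    then show ?case using elim by simp
  qed
  then show "(\<lambda>\<omega>. norm (IO g phi a b \<omega> f - (\<Sum>k<n. w \<omega> k * f (x \<omega> k))))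
        \<in> O[at_top](\<lambda>\<omega>. \<omega> powr (- real n - 1))"
    by (rule bigoI)
qed

end
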